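(* Let $G$ be a finite group, $H$ a normal subgroup of $G$, $k$ a field whose characteristic is coprime to $|G|$, and let $A$ be a $G/H$-graded $k$-algebra. Then $A$ is also a partially $G$-graded algebra by $$p_g\cdot a=\frac1{|H|}\,q_{gH}\rightharpoonup a\qquad(g\in G,\ a\in A).$$
   Context: For a finite group $G$, $k^G=(kG)^*$ is the dual group algebra with basis $\{p_g\}_{g\in G}$, $p_g(h)=\delta_{g,h}$. A partial $G$-grading on a unital $k$-algebra $A$ consists of linear operators $p_g\cdot-$ on $A$ ($g\in G$) such that for all $a,b\in A$, $g,t\in G$: (1) $\sum_{g\in G}p_g\cdot a=a$; (2) $p_g\cdot(ab)=\sum_{l\in G}(p_{gl^{-1}}\cdot a)(p_l\cdot b)$; (3) $p_g\cdot(p_t\cdot a)=(p_{gt^{-1}}\cdot1_A)(p_t\cdot a)=(p_t\cdot a)(p_{t^{-1}g}\cdot1_A)$. For a normal subgroup $H$ of $G$, the canonical basis elements of $k^{G/H}$ are denoted $q_{gH}$. A $G/H$-graded algebra $A$ is viewed as a $k^{G/H}$-module algebra, where $q_{gH}\rightharpoonup a$ is the homogeneous component of $a$ of degree $gH$. *)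

theory Defs
  imports "HOL-Algebra.Coset" "HOL-Algebra.Module"
begin

definition ring_characteristic :: "('k, 'm) ring_scheme \<Rightarrow> nat" where
  "ring_characteristic K =
     (if \<exists>n::nat. n > 0 \<and> [n] \<cdot>\<^bsub>K\<^esub> \<one>\<^bsub>K\<^esub> = \<zero>\<^bsub>K\<^esub>
      then LEAST n::nat. n > 0 \<and> [n] \<cdot>\<^bsub>K\<^esub> \<one>\<^bsub>K\<^esub> = \<zero>\<^bsub>K\<^esub> else 0)"

text \<open>The library locale \<^locale>\<open>algebra\<close> requires commutative multiplication; the algebras
  here are associative and unital, but not necessarily commutative.\<close>

locale unital_algebra = module K A + ring A for K and A (structure) +
  assumes smult_mult_left:
    "\<lbrakk>r \<in> carrier K; x \<in> carrier A; y \<in> carrier A\<rbrakk> \<Longrightarrow>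
       (r \<odot>\<^bsub>A\<^esub> x) \<otimes>\<^bsub>A\<^esub> y = r \<odot>\<^bsub>A\<^esub> (x \<otimes>\<^bsub>A\<^esub> y)"
  and smult_mult_right:
    "\<lbrakk>r \<in> carrier K; x \<in> carrier A; y \<in> carrier A\<rbrakk> \<Longrightarrow>
       x \<otimes>\<^bsub>A\<^esub> (r \<odot>\<^bsub>A\<^esub> y) = r \<odot>\<^bsub>A\<^esub> (x \<otimes>\<^bsub>A\<^esub> y)"

definition linear_operator ::
  "('k, 'm) ring_scheme \<Rightarrow> ('k, 'a, 'n) module_scheme \<Rightarrow> ('a \<Rightarrow> 'a) \<Rightarrow> bool" where
  "linear_operator K A f \<longleftrightarrow>
     f \<in> carrier A \<rightarrow> carrier A \<and>
     (\<forall>x\<in>carrier A. \<forall>y\<in>carrier A. f (x \<oplus>\<^bsub>A\<^esub> y) = f x \<oplus>\<^bsub>A\<^esub> f y) \<and>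
     (\<forall>r\<in>carrier K. \<forall>x\<in>carrier A. f (r \<odot>\<^bsub>A\<^esub> x) = r \<odot>\<^bsub>A\<^esub> f x)"

text \<open>Here \<open>D x\<close> is the homogeneous subspace of degree \<open>x\<close>, and \<open>c x\<close> is the component of
  \<open>a\<close> of degree \<open>x\<close>. The extensional function space makes \<open>c\<close> unique as a HOL function.
  The sum runs over the support because \<^const>\<open>finsum\<close> is only meaningful on finite sets.\<close>

definition homogeneous_decomposition ::
  "('q, 'l) monoid_scheme \<Rightarrow> ('k, 'a, 'n) module_scheme \<Rightarrow> ('q \<Rightarrow> 'a set) \<Rightarrow> 'a
     \<Rightarrow> ('q \<Rightarrow> 'a) \<Rightarrow> bool" where
  "homogeneous_decomposition Q A D a c \<longleftrightarrow>
     c \<in> (\<Pi>\<^sub>E x\<in>carrier Q. D x) \<and>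
     finite {x \<in> carrier Q. c x \<noteq> \<zero>\<^bsub>A\<^esub>} \<and>
     a = (\<Oplus>\<^bsub>A\<^esub> x \<in> {x \<in> carrier Q. c x \<noteq> \<zero>\<^bsub>A\<^esub>}. c x)"

definition homogeneous_component ::
  "('q, 'l) monoid_scheme \<Rightarrow> ('k, 'a, 'n) module_scheme \<Rightarrow> ('q \<Rightarrow> 'a set) \<Rightarrow> 'q
     \<Rightarrow> 'a \<Rightarrow> 'a" where
  "homogeneous_component Q A D x a = (THE c. homogeneous_decomposition Q A D a c) x"

text \<open>Unique existence of decompositions says that \<open>A\<close> is the internal direct sum of the \<open>D x\<close>.\<close>

locale graded_algebra = Q: group Q + unital_algebra K A
  for Q :: "('q, 'l) monoid_scheme" (structure)
    and K :: "('k, 'm) ring_scheme" and A :: "('k, 'a, 'n) module_scheme" (structure)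
    and D :: "'q \<Rightarrow> 'a set" +
  assumes component_submodule: "x \<in> carrier Q \<Longrightarrow> submodule (D x) K A"
    and component_mult:
      "\<lbrakk>x \<in> carrier Q; y \<in> carrier Q; a \<in> D x; b \<in> D y\<rbrakk> \<Longrightarrow>
         a \<otimes>\<^bsub>A\<^esub> b \<in> D (x \<otimes>\<^bsub>Q\<^esub> y)"
    and direct_sum: "a \<in> carrier A \<Longrightarrow> \<exists>!c. homogeneous_decomposition Q A D a c"

text \<open>\<open>p g a\<close> stands for the action of the dual basis element of \<open>g\<close> on \<open>a\<close>.\<close>

locale partial_grading = G: group G + unital_algebra K A
  for G :: "('g, 'l) monoid_scheme" (structure)
    and K :: "('k, 'm) ring_scheme" and A :: "('k, 'a, 'n) module_scheme" (structure)
    and p :: "'g \<Rightarrow> 'a \<Rightarrow> 'a" +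
  assumes finite_group: "finite (carrier G)"
    and linear: "g \<in> carrier G \<Longrightarrow> linear_operator K A (p g)"
    and sum_components: "a \<in> carrier A \<Longrightarrow> (\<Oplus>\<^bsub>A\<^esub> g \<in> carrier G. p g a) = a"
    and component_of_mult:
      "\<lbrakk>g \<in> carrier G; a \<in> carrier A; b \<in> carrier A\<rbrakk> \<Longrightarrow>
         p g (a \<otimes>\<^bsub>A\<^esub> b) =
         (\<Oplus>\<^bsub>A\<^esub> l \<in> carrier G. p (g \<otimes>\<^bsub>G\<^esub> inv\<^bsub>G\<^esub> l) a \<otimes>\<^bsub>A\<^esub> p l b)"
    and partial_left:
      "\<lbrakk>g \<in> carrier G; t \<in> carrier G; a \<in> carrier A\<rbrakk> \<Longrightarrow>
         p g (p t a) = p (g \<otimes>\<^bsub>G\<^esub> inv\<^bsub>G\<^esub> t) \<one>\<^bsub>A\<^esub> \<otimes>\<^bsub>A\<^esub> p t a"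
    and partial_right:
      "\<lbrakk>g \<in> carrier G; t \<in> carrier G; a \<in> carrier A\<rbrakk> \<Longrightarrow>
         p g (p t a) = p t a \<otimes>\<^bsub>A\<^esub> p (inv\<^bsub>G\<^esub> t \<otimes>\<^bsub>G\<^esub> g) \<one>\<^bsub>A\<^esub>"

end

theory Submission
  imports Defs
begin

text \<open>Write \<open>a\<^sub>x\<close> for the component of \<open>a\<close> of degree \<open>x\<close> in \<open>Q = G/H\<close>, and \<open>s = 1/|H|\<close>. The scalar
  exists because \<open>|H|\<close> divides \<open>|G|\<close> and is therefore nonzero in the field
  (\<open>card_subgroup_nonzero\<close>). The operators \<open>a \<mapsto> s a\<^sub>g\<^sub>H\<close> copy the grading by \<open>Q\<close> onto every
  element of each coset, and \<open>s\<close> compensates for the repetition: a function \<open>f\<close> on \<open>Q\<close> satisfies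
  \<open>\<Sum>\<^bsub>g \<in> G\<^esub> s f(gH) = \<Sum>\<^bsub>x \<in> Q\<^esub> f(x)\<close> (\<open>finsum_coset_average\<close>).

  Hence the sum of the operators is the sum of all components, namely \<open>a\<close>. Likewise the
  convolution of \<open>s a\<close> and \<open>s b\<close> over \<open>G\<close> has two factors \<open>s\<close>, one of which is used up by the
  averaging; what remains is \<open>s\<close> times the formula
  \<open>(a b)\<^sub>x = \<Sum>\<^bsub>y \<in> Q\<^esub> a\<^sub>z b\<^sub>y\<close> with \<open>z = x y\<^sup>-\<^sup>1\<close> (\<open>comp_mult\<close>), valid in every algebra graded by a
  finite group.

  For the two partiality axioms, \<open>(a\<^sub>t\<^sub>H)\<^sub>g\<^sub>H\<close> is \<open>a\<^sub>t\<^sub>H\<close> if \<open>gH = tH\<close> and \<open>0\<close> otherwise. Multiplying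
  \<open>a\<^sub>t\<^sub>H\<close> by the component of \<open>1\<close> of degree \<open>g t\<^sup>-\<^sup>1 H\<close> or \<open>t\<^sup>-\<^sup>1 g H\<close> gives the same result, because
  \<open>1\<close> is homogeneous of degree \<open>H\<close> (\<open>one_homogeneous\<close>) and these degrees equal \<open>H\<close> exactly
  when \<open>gH = tH\<close>. Both sides carry \<open>s\<close> twice.\<close>

section \<open>Inverting the order of a subgroup\<close>

text \<open>The positive numbers annihilating \<open>1\<close> are multiples of the characteristic, so a vanishing
  \<open>|H|\<close> would make a positive characteristic divide \<open>|H|\<close>, hence \<open>|G|\<close>; coprimality then forces
  \<open>1 = 0\<close>.\<close>

lemma (in field) card_subgroup_nonzero:
  assumes G: "group G" "finite (carrier G)" and H: "subgroup H G"
    and char: "ring_characteristic R = 0 \<or> coprime (ring_characteristic R) (order G)"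
  shows "[card H] \<cdot>\<^bsub>R\<^esub> \<one>\<^bsub>R\<^esub> \<noteq> \<zero>\<^bsub>R\<^esub>"
proof
  assume zero: "[card H] \<cdot>\<^bsub>R\<^esub> \<one>\<^bsub>R\<^esub> = \<zero>\<^bsub>R\<^esub>"
  have "card H > 0"
    using H G(2) by (metis card_gt_0_iff empty_iff finite_subset subgroup.one_closed subgroup.subset)
  let ?P = "\<lambda>n::nat. n > 0 \<and> [n] \<cdot>\<^bsub>R\<^esub> \<one>\<^bsub>R\<^esub> = \<zero>\<^bsub>R\<^esub>"
  define m where "m = ring_characteristic R"
  have ex: "\<exists>n. ?P n" using \<open>card H > 0\<close> zero by blast
  have m: "m = (LEAST n. ?P n)" unfolding m_def ring_characteristic_def using ex by simp
  have Pm: "?P m" unfolding m using ex by (rule LeastI_ex)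
  \<comment> \<open>A nonzero remainder would be a smaller positive number annihilating \<open>1\<close>.\<close>
  have "card H mod m = 0"
  proof (rule ccontr)
    assume neq: "card H mod m \<noteq> 0"
    have "\<zero>\<^bsub>R\<^esub> = [(m * (card H div m) + card H mod m)] \<cdot>\<^bsub>R\<^esub> \<one>\<^bsub>R\<^esub>" using zero by simp
    also have "\<dots> = [(card H div m)] \<cdot>\<^bsub>R\<^esub> ([m] \<cdot>\<^bsub>R\<^esub> \<one>\<^bsub>R\<^esub>) \<oplus>\<^bsub>R\<^esub> [(card H mod m)] \<cdot>\<^bsub>R\<^esub> \<one>\<^bsub>R\<^esub>"
      by (simp add: add.nat_pow_mult add.nat_pow_pow)
    also have "\<dots> = [(card H mod m)] \<cdot>\<^bsub>R\<^esub> \<one>\<^bsub>R\<^esub>" using Pm by simp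
    finally have "?P (card H mod m)" using neq by simp
    then have "m \<le> card H mod m" unfolding m by (rule Least_le)
    then show False using Pm by (meson mod_less_divisor not_le)
  qed
  moreover have "card H dvd order G" using group.lagrange[OF G(1) H] by (metis dvd_triv_right)
  ultimately have "m dvd order G" by (meson dvd_trans mod_0_imp_dvd)
  then have "m = 1"
    using char Pm unfolding m_def by (metis coprime_common_divisor_nat dvd_refl less_numeral_extra(3))
  then show False using Pm by simp
qed

section \<open>Averaging over cosets\<close>

lemma (in module) smult_nat_multiple_one:
  assumes "x \<in> carrier M"
  shows "([(n::nat)] \<cdot>\<^bsub>R\<^esub> \<one>\<^bsub>R\<^esub>) \<odot>\<^bsub>M\<^esub> x = [n] \<cdot>\<^bsub>M\<^esub> x"
  using assms by (induction n) (simp_all add: smult_l_distr)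

text \<open>The cosets partition the group into blocks of \<open>|H|\<close> elements on which the summand is constant,
  and \<open>s\<close> is the inverse of \<open>|H|\<close>.\<close>

lemma (in module) finsum_coset_average:
  assumes G: "group G" "finite (carrier G)" and H: "subgroup H G"
    and s: "s \<in> carrier R" "([card H] \<cdot>\<^bsub>R\<^esub> \<one>\<^bsub>R\<^esub>) \<otimes>\<^bsub>R\<^esub> s = \<one>\<^bsub>R\<^esub>"
    and f: "f \<in> rcosets\<^bsub>G\<^esub> H \<rightarrow> carrier M"
  shows "(\<Oplus>\<^bsub>M\<^esub> g \<in> carrier G. s \<odot>\<^bsub>M\<^esub> f (H #>\<^bsub>G\<^esub> g)) = (\<Oplus>\<^bsub>M\<^esub> X \<in> rcosets\<^bsub>G\<^esub> H. f X)"
proof -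
  interpret G: group G by (rule G(1))
  have sub: "H \<subseteq> carrier G" using H by (rule subgroup.subset)
  have mem: "H #>\<^bsub>G\<^esub> g \<in> rcosets\<^bsub>G\<^esub> H" if "g \<in> carrier G" for g
    using sub that by (rule G.rcosetsI)
  have un: "\<Union>(rcosets\<^bsub>G\<^esub> H) = carrier G" by (rule G.rcosets_part_G[OF H])
  have fin: "\<forall>X\<in>rcosets\<^bsub>G\<^esub> H. finite X"
    using un G(2) by (metis Union_upper finite_subset)
  have disj: "pairwise disjnt (rcosets\<^bsub>G\<^esub> H)" by (rule G.rcos_disjoint[OF H])
  have "(\<Oplus>\<^bsub>M\<^esub> g \<in> \<Union>(rcosets\<^bsub>G\<^esub> H). s \<odot>\<^bsub>M\<^esub> f (H #>\<^bsub>G\<^esub> g))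
      = (\<Oplus>\<^bsub>M\<^esub> X \<in> rcosets\<^bsub>G\<^esub> H. \<Oplus>\<^bsub>M\<^esub> g \<in> X. s \<odot>\<^bsub>M\<^esub> f (H #>\<^bsub>G\<^esub> g))"
  proof (rule M.add.finprod_Union_disjoint)
    show "finite (rcosets\<^bsub>G\<^esub> H)" using un G(2) by (metis finite_UnionD)
    show "finite X \<and> (\<forall>g\<in>X. s \<odot>\<^bsub>M\<^esub> f (H #>\<^bsub>G\<^esub> g) \<in> carrier M)"
      if "X \<in> rcosets\<^bsub>G\<^esub> H" for X
    proof -
      have "g \<in> carrier G" if "g \<in> X" for g using that \<open>X \<in> rcosets\<^bsub>G\<^esub> H\<close> un by blast
      then show ?thesis using that fin mem f s(1) by (simp add: Pi_def)
    qed
    show "pairwise disjnt (rcosets\<^bsub>G\<^esub> H)" by (rule disj)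
  qed
  also have "\<dots> = (\<Oplus>\<^bsub>M\<^esub> X \<in> rcosets\<^bsub>G\<^esub> H. f X)"
  proof (rule M.finsum_cong')
    fix X assume X: "X \<in> rcosets\<^bsub>G\<^esub> H"
    have fX: "f X \<in> carrier M" using f X by blast
    have "H #>\<^bsub>G\<^esub> g = X" if "g \<in> X" for g
      using X that H sub G.repr_independence unfolding RCOSETS_def by fastforce
    then have "(\<Oplus>\<^bsub>M\<^esub> g \<in> X. s \<odot>\<^bsub>M\<^esub> f (H #>\<^bsub>G\<^esub> g)) = (\<Oplus>\<^bsub>M\<^esub> g \<in> X. s \<odot>\<^bsub>M\<^esub> f X)"
      using fX s by (intro M.finsum_cong') auto
    also have "\<dots> = [card H] \<cdot>\<^bsub>M\<^esub> (s \<odot>\<^bsub>M\<^esub> f X)"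
      using fX s G.card_rcosets_equal[OF X sub] by (simp add: M.add.finprod_const)
    also have "\<dots> = f X"
      using fX s by (simp add: smult_nat_multiple_one[symmetric] smult_assoc1[symmetric])
    finally show "(\<Oplus>\<^bsub>M\<^esub> g \<in> X. s \<odot>\<^bsub>M\<^esub> f (H #>\<^bsub>G\<^esub> g)) = f X" .
  qed (use f in auto)
  finally show ?thesis by (simp add: un)
qed

section \<open>Homogeneous components for a finite grading group\<close>

abbreviation (in graded_algebra) comp :: "'q \<Rightarrow> 'a \<Rightarrow> 'a" where
  "comp \<equiv> homogeneous_component Q A D"

lemma (in graded_algebra) component_subset: "x \<in> carrier Q \<Longrightarrow> D x \<subseteq> carrier A"
  using submoduleE(1)[OF component_submodule] .

text \<open>Over a finite grading group, vanishing components can be kept in the sum. The support, which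
  depends on the element, then disappears from all later computations.\<close>

lemma (in graded_algebra) decomposition_iff:
  assumes "finite (carrier Q)"
  shows "homogeneous_decomposition Q A D a c \<longleftrightarrow>
    c \<in> (\<Pi>\<^sub>E x\<in>carrier Q. D x) \<and> a = (\<Oplus>\<^bsub>A\<^esub> x \<in> carrier Q. c x)"
proof (cases "c \<in> (\<Pi>\<^sub>E x\<in>carrier Q. D x)")
  case True
  then have "c x \<in> carrier A" if "x \<in> carrier Q" for x
    using that component_subset by (auto simp: PiE_def Pi_def)
  then have "(\<Oplus>\<^bsub>A\<^esub> x \<in> {x \<in> carrier Q. c x \<noteq> \<zero>\<^bsub>A\<^esub>}. c x) = (\<Oplus>\<^bsub>A\<^esub> x \<in> carrier Q. c x)"
    using assms by (intro add.finprod_mono_neutral_cong_left) auto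
  then show ?thesis using assms by (simp add: homogeneous_decomposition_def)
qed (simp add: homogeneous_decomposition_def)

lemma (in graded_algebra)
  assumes fin: "finite (carrier Q)" and a: "a \<in> carrier A"
  shows comp_in_component: "x \<in> carrier Q \<Longrightarrow> comp x a \<in> D x"
    and finsum_comp: "(\<Oplus>\<^bsub>A\<^esub> x \<in> carrier Q. comp x a) = a"
proof -
  let ?c = "THE c. homogeneous_decomposition Q A D a c"
  have "homogeneous_decomposition Q A D a ?c" using direct_sum[OF a] by (rule theI')
  then have c: "?c \<in> (\<Pi>\<^sub>E x\<in>carrier Q. D x)" "a = (\<Oplus>\<^bsub>A\<^esub> x \<in> carrier Q. ?c x)"
    by (simp_all add: decomposition_iff[OF fin])
  show "x \<in> carrier Q \<Longrightarrow> comp x a \<in> D x"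
    using c(1) unfolding homogeneous_component_def by (rule PiE_mem)
  show "(\<Oplus>\<^bsub>A\<^esub> x \<in> carrier Q. comp x a) = a"
    using c(2) unfolding homogeneous_component_def by (rule sym)
qed

lemma (in graded_algebra) comp_closed:
  assumes "finite (carrier Q)" "a \<in> carrier A" "x \<in> carrier Q"
  shows "comp x a \<in> carrier A"
  using comp_in_component[OF assms] component_subset[OF assms(3)] by blast

text \<open>This is how every formula for components below is proved: exhibit a family with the right
  degrees and the right sum.\<close>

lemma (in graded_algebra) comp_unique:
  assumes fin: "finite (carrier Q)"
    and c: "\<And>x. x \<in> carrier Q \<Longrightarrow> c x \<in> D x"
    and a: "(\<Oplus>\<^bsub>A\<^esub> x \<in> carrier Q. c x) = a"
    and x: "x \<in> carrier Q"
  shows "comp x a = c x"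
proof -
  have cA: "c \<in> carrier Q \<rightarrow> carrier A" using c component_subset by blast
  then have "a \<in> carrier A" using a by auto
  let ?c = "restrict c (carrier Q)"
  have "(\<Oplus>\<^bsub>A\<^esub> x \<in> carrier Q. ?c x) = a"
    unfolding a[symmetric] using cA by (intro finsum_cong') auto
  then have "homogeneous_decomposition Q A D a ?c"
    using c by (auto simp: decomposition_iff[OF fin])
  then have "(THE c. homogeneous_decomposition Q A D a c) = ?c"
    using direct_sum[OF \<open>a \<in> carrier A\<close>] by (intro the1_equality)
  then show ?thesis using x by (simp add: homogeneous_component_def)
qed

lemma (in graded_algebra) comp_add:
  assumes fin: "finite (carrier Q)" and ab: "a \<in> carrier A" "b \<in> carrier A" and x: "x \<in> carrier Q"
  shows "comp x (a \<oplus>\<^bsub>A\<^esub> b) = comp x a \<oplus>\<^bsub>A\<^esub> comp x b"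
proof (rule comp_unique[OF fin _ _ x])
  show "comp x a \<oplus>\<^bsub>A\<^esub> comp x b \<in> D x" if "x \<in> carrier Q" for x
    using submoduleE(5)[OF component_submodule[OF that]] comp_in_component[OF fin _ that] ab by blast
  show "(\<Oplus>\<^bsub>A\<^esub> x \<in> carrier Q. comp x a \<oplus>\<^bsub>A\<^esub> comp x b) = a \<oplus>\<^bsub>A\<^esub> b"
    using ab comp_closed[OF fin] by (simp add: finsum_addf finsum_comp[OF fin] Pi_def)
qed

lemma (in graded_algebra) comp_smult:
  assumes fin: "finite (carrier Q)" and r: "r \<in> carrier K" and a: "a \<in> carrier A"
    and x: "x \<in> carrier Q"
  shows "comp x (r \<odot>\<^bsub>A\<^esub> a) = r \<odot>\<^bsub>A\<^esub> comp x a"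
proof (rule comp_unique[OF fin _ _ x])
  show "r \<odot>\<^bsub>A\<^esub> comp x a \<in> D x" if "x \<in> carrier Q" for x
    using submoduleE(4)[OF component_submodule[OF that] r] comp_in_component[OF fin a that] by blast
  show "(\<Oplus>\<^bsub>A\<^esub> x \<in> carrier Q. r \<odot>\<^bsub>A\<^esub> comp x a) = r \<odot>\<^bsub>A\<^esub> a"
    using r a comp_closed[OF fin]
    by (simp add: finsum_smult_ldistr[OF fin, symmetric] finsum_comp[OF fin] Pi_def)
qed

lemma (in graded_algebra) comp_homogeneous:
  assumes fin: "finite (carrier Q)" and y: "y \<in> carrier Q" and a: "a \<in> D y"
    and x: "x \<in> carrier Q"
  shows "comp x a = (if x = y then a else \<zero>\<^bsub>A\<^esub>)"
proof (rule comp_unique[OF fin _ _ x])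
  have aA: "a \<in> carrier A" using a y component_subset by blast
  show "(if x = y then a else \<zero>\<^bsub>A\<^esub>) \<in> D x" if "x \<in> carrier Q" for x
    using a subgroup.one_closed[OF submodule.axioms(1)[OF component_submodule[OF that]]] by simp
  show "(\<Oplus>\<^bsub>A\<^esub> x \<in> carrier Q. if x = y then a else \<zero>\<^bsub>A\<^esub>) = a"
    using add.finprod_singleton_swap[OF y fin, of "\<lambda>_. a"] aA by simp
qed

lemma (in graded_algebra) comp_finsum:
  assumes fin: "finite (carrier Q)" and x: "x \<in> carrier Q"
    and "finite I" "f \<in> I \<rightarrow> carrier A"
  shows "comp x (\<Oplus>\<^bsub>A\<^esub> i \<in> I. f i) = (\<Oplus>\<^bsub>A\<^esub> i \<in> I. comp x (f i))"
  using assms(3,4)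
proof (induction I)
  case empty
  have "\<zero>\<^bsub>A\<^esub> \<in> D x"
    using subgroup.one_closed[OF submodule.axioms(1)[OF component_submodule[OF x]]] by simp
  then show ?case using comp_homogeneous[OF fin x _ x] by simp
next
  case (insert i I)
  then show ?case using comp_closed[OF fin _ x] by (simp add: comp_add[OF fin _ _ x] Pi_def)
qed

text \<open>Multiplying the decomposition of \<open>a\<close> by \<open>b\<close> on the right moves degree \<open>z\<close> to degree \<open>z y\<close>; right
  translation by the inverse of \<open>y\<close> permutes the group, so the translated family has sum \<open>a b\<close>.\<close>

lemma (in graded_algebra) comp_mult_homogeneous:
  assumes fin: "finite (carrier Q)" and a: "a \<in> carrier A" and y: "y \<in> carrier Q"
    and b: "b \<in> D y" and x: "x \<in> carrier Q"
  shows "comp x (a \<otimes>\<^bsub>A\<^esub> b) = comp (x \<otimes>\<^bsub>Q\<^esub> inv\<^bsub>Q\<^esub> y) a \<otimes>\<^bsub>A\<^esub> b"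
proof (rule comp_unique[OF fin _ _ x])
  have bA: "b \<in> carrier A" using b y component_subset by blast
  show "comp (x \<otimes>\<^bsub>Q\<^esub> inv\<^bsub>Q\<^esub> y) a \<otimes>\<^bsub>A\<^esub> b \<in> D x" if "x \<in> carrier Q" for x
    using component_mult[OF _ y comp_in_component[OF fin a] b, of "x \<otimes>\<^bsub>Q\<^esub> inv\<^bsub>Q\<^esub> y"] that y
    by (simp add: Q.m_assoc)
  have inj: "inj_on (\<lambda>x. x \<otimes>\<^bsub>Q\<^esub> inv\<^bsub>Q\<^esub> y) (carrier Q)"
    using y by (auto intro: inj_onI)
  have img: "(\<lambda>x. x \<otimes>\<^bsub>Q\<^esub> inv\<^bsub>Q\<^esub> y) ` carrier Q = carrier Q"
    using y by (intro endo_inj_surj[OF fin _ inj]) auto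
  have "(\<Oplus>\<^bsub>A\<^esub> x \<in> carrier Q. comp (x \<otimes>\<^bsub>Q\<^esub> inv\<^bsub>Q\<^esub> y) a \<otimes>\<^bsub>A\<^esub> b)
      = (\<Oplus>\<^bsub>A\<^esub> x \<in> carrier Q. comp x a \<otimes>\<^bsub>A\<^esub> b)"
    using finsum_reindex[OF _ inj, of "\<lambda>x. comp x a \<otimes>\<^bsub>A\<^esub> b"] comp_closed[OF fin a] bA
    by (simp add: img Pi_def)
  also have "\<dots> = a \<otimes>\<^bsub>A\<^esub> b"
    using finsum_ldistr[OF fin bA, of "\<lambda>x. comp x a"] comp_closed[OF fin a]
    by (simp add: finsum_comp[OF fin a] Pi_def)
  finally show "(\<Oplus>\<^bsub>A\<^esub> x \<in> carrier Q. comp (x \<otimes>\<^bsub>Q\<^esub> inv\<^bsub>Q\<^esub> y) a \<otimes>\<^bsub>A\<^esub> b) = a \<otimes>\<^bsub>A\<^esub> b" .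
qed

text \<open>Decomposing only \<open>b\<close> first, and using additivity of the component map, reduces to homogeneous
  \<open>b\<close> without interchanging a double sum.\<close>

lemma (in graded_algebra) comp_mult:
  assumes fin: "finite (carrier Q)" and ab: "a \<in> carrier A" "b \<in> carrier A"
    and x: "x \<in> carrier Q"
  shows "comp x (a \<otimes>\<^bsub>A\<^esub> b)
    = (\<Oplus>\<^bsub>A\<^esub> y \<in> carrier Q. comp (x \<otimes>\<^bsub>Q\<^esub> inv\<^bsub>Q\<^esub> y) a \<otimes>\<^bsub>A\<^esub> comp y b)"
proof -
  have "a \<otimes>\<^bsub>A\<^esub> b = (\<Oplus>\<^bsub>A\<^esub> y \<in> carrier Q. a \<otimes>\<^bsub>A\<^esub> comp y b)"
    using finsum_rdistr[OF fin ab(1), of "\<lambda>y. comp y b"] comp_closed[OF fin ab(2)]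
    by (simp add: finsum_comp[OF fin ab(2)] Pi_def)
  also have "comp x \<dots> = (\<Oplus>\<^bsub>A\<^esub> y \<in> carrier Q. comp x (a \<otimes>\<^bsub>A\<^esub> comp y b))"
    using comp_closed[OF fin ab(2)] ab(1) by (intro comp_finsum[OF fin x fin]) auto
  also have "\<dots> = (\<Oplus>\<^bsub>A\<^esub> y \<in> carrier Q. comp (x \<otimes>\<^bsub>Q\<^esub> inv\<^bsub>Q\<^esub> y) a \<otimes>\<^bsub>A\<^esub> comp y b)"
    using comp_closed[OF fin] ab x
    by (intro finsum_cong')
      (auto simp: comp_mult_homogeneous[OF fin ab(1) _ comp_in_component[OF fin ab(2)] x])
  finally show ?thesis .
qed

text \<open>Let \<open>e\<close> be the component of \<open>1\<close> of neutral degree. For homogeneous \<open>a\<close> of degree \<open>x\<close>, comparing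
  components of degree \<open>x\<close> in \<open>a = a 1\<close> gives \<open>a = a e\<close>. Applied to the components of \<open>1\<close> and
  summed, this yields \<open>1 = 1 e = e\<close>.\<close>

lemma (in graded_algebra) one_homogeneous:
  assumes fin: "finite (carrier Q)"
  shows "\<one>\<^bsub>A\<^esub> \<in> D \<one>\<^bsub>Q\<^esub>"
proof -
  let ?e = "comp \<one>\<^bsub>Q\<^esub> \<one>\<^bsub>A\<^esub>"
  have e: "?e \<in> D \<one>\<^bsub>Q\<^esub>" "?e \<in> carrier A"
    using comp_in_component[OF fin] comp_closed[OF fin] by simp_all
  have unit: "comp x \<one>\<^bsub>A\<^esub> \<otimes>\<^bsub>A\<^esub> ?e = comp x \<one>\<^bsub>A\<^esub>" if x: "x \<in> carrier Q" for x
  proof -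
    let ?a = "comp x \<one>\<^bsub>A\<^esub>"
    have a: "?a \<in> D x" "?a \<in> carrier A"
      using comp_in_component[OF fin] comp_closed[OF fin] x by simp_all
    \<comment> \<open>Only the summand with \<open>x y\<^sup>-\<^sup>1 = x\<close> survives, since \<open>?a\<close> is homogeneous of degree \<open>x\<close>.\<close>
    have "?a = comp x (?a \<otimes>\<^bsub>A\<^esub> \<one>\<^bsub>A\<^esub>)" using a comp_homogeneous[OF fin x a(1) x] by simp
    also have "\<dots> = (\<Oplus>\<^bsub>A\<^esub> y \<in> carrier Q. comp (x \<otimes>\<^bsub>Q\<^esub> inv\<^bsub>Q\<^esub> y) ?a \<otimes>\<^bsub>A\<^esub> comp y \<one>\<^bsub>A\<^esub>)"
      using a x by (intro comp_mult[OF fin]) auto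
    also have "\<dots> = (\<Oplus>\<^bsub>A\<^esub> y \<in> carrier Q. if y = \<one>\<^bsub>Q\<^esub> then ?a \<otimes>\<^bsub>A\<^esub> ?e else \<zero>\<^bsub>A\<^esub>)"
    proof (rule finsum_cong')
      fix y assume y: "y \<in> carrier Q"
      have "x \<otimes>\<^bsub>Q\<^esub> inv\<^bsub>Q\<^esub> y = x \<longleftrightarrow> y = \<one>\<^bsub>Q\<^esub>"
        using x y Q.inv_eq_1_iff[OF y] Q.r_cancel_one[OF x, of "inv\<^bsub>Q\<^esub> y"] by simp
      then show "comp (x \<otimes>\<^bsub>Q\<^esub> inv\<^bsub>Q\<^esub> y) ?a \<otimes>\<^bsub>A\<^esub> comp y \<one>\<^bsub>A\<^esub>
          = (if y = \<one>\<^bsub>Q\<^esub> then ?a \<otimes>\<^bsub>A\<^esub> ?e else \<zero>\<^bsub>A\<^esub>)"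
        using x y comp_closed[OF fin] by (simp add: comp_homogeneous[OF fin x a(1)])
    qed (use a e in auto)
    also have "\<dots> = ?a \<otimes>\<^bsub>A\<^esub> ?e"
      using add.finprod_singleton_swap[OF Q.one_closed fin, of "\<lambda>_. ?a \<otimes>\<^bsub>A\<^esub> ?e"] a e by simp
    finally show ?thesis by (rule sym)
  qed
  have "?e = (\<Oplus>\<^bsub>A\<^esub> x \<in> carrier Q. comp x \<one>\<^bsub>A\<^esub>) \<otimes>\<^bsub>A\<^esub> ?e"
    using e by (simp add: finsum_comp[OF fin])
  also have "\<dots> = (\<Oplus>\<^bsub>A\<^esub> x \<in> carrier Q. comp x \<one>\<^bsub>A\<^esub> \<otimes>\<^bsub>A\<^esub> ?e)"
    using comp_closed[OF fin] by (intro finsum_ldistr[OF fin e(2)]) auto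
  also have "\<dots> = (\<Oplus>\<^bsub>A\<^esub> x \<in> carrier Q. comp x \<one>\<^bsub>A\<^esub>)"
    using comp_closed[OF fin] unit by (intro finsum_cong') auto
  also have "\<dots> = \<one>\<^bsub>A\<^esub>" by (simp add: finsum_comp[OF fin])
  finally show ?thesis using e(1) by simp
qed

section \<open>The partial grading\<close>

theorem proposition6p4:
  fixes G :: "('g, 'l) monoid_scheme"
    and K :: "('k, 'm) ring_scheme"
    and A :: "('k, 'a, 'n) module_scheme"
    and H :: "'g set"
    and D :: "'g set \<Rightarrow> 'a set"
  assumes "group G" and "finite (carrier G)"
    and "H \<lhd> G"
    and "field K"
    and "ring_characteristic K = 0 \<or> coprime (ring_characteristic K) (order G)"
    and "graded_algebra (G Mod H) K A D"
  shows "partial_grading G K A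
    (\<lambda>g a. inv\<^bsub>K\<^esub> ([card H] \<cdot>\<^bsub>K\<^esub> \<one>\<^bsub>K\<^esub>) \<odot>\<^bsub>A\<^esub>
             homogeneous_component (G Mod H) A D (g <#\<^bsub>G\<^esub> H) a)"
proof -
  interpret G: group G by (rule assms(1))
  interpret H: normal H G by (rule assms(3))
  interpret F: field K by (rule assms(4))
  interpret gr: graded_algebra "G Mod H" K A D by (rule assms(6))
  have subH: "subgroup H G" by (rule H.subgroup_axioms)
  define n where "n = [card H] \<cdot>\<^bsub>K\<^esub> \<one>\<^bsub>K\<^esub>"
  define s where "s = inv\<^bsub>K\<^esub> n"
  have "n \<in> carrier K" "n \<noteq> \<zero>\<^bsub>K\<^esub>"
    using F.card_subgroup_nonzero[OF assms(1,2) subH assms(5)] by (simp_all add: n_def)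
  then have "n \<in> Units K" by (simp add: F.field_Units)
  then have s: "s \<in> carrier K" "n \<otimes>\<^bsub>K\<^esub> s = \<one>\<^bsub>K\<^esub>" by (simp_all add: s_def)
  define q where "q = gr.comp"
  define r where "r = (\<lambda>g. H #>\<^bsub>G\<^esub> g)"
  have carrier_Q: "carrier (G Mod H) = rcosets\<^bsub>G\<^esub> H" by (simp add: FactGroup_def)
  have fin: "finite (carrier (G Mod H))"
    using assms(2) by (simp add: carrier_FactGroup)
  \<comment> \<open>The action is indexed by left cosets, while the quotient group consists of right cosets.\<close>
  have lr: "g <#\<^bsub>G\<^esub> H = r g" if "g \<in> carrier G" for g
    using H.coset_eq that by (simp add: r_def)
  have r_mem: "r g \<in> carrier (G Mod H)" if "g \<in> carrier G" for g
    using that by (simp add: r_def carrier_FactGroup)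
  have r_mult: "r (g \<otimes>\<^bsub>G\<^esub> h) = r g \<otimes>\<^bsub>G Mod H\<^esub> r h" if "g \<in> carrier G" "h \<in> carrier G" for g h
    using that by (simp add: r_def H.rcos_sum)
  have r_inv: "r (inv\<^bsub>G\<^esub> g) = inv\<^bsub>G Mod H\<^esub> r g" if "g \<in> carrier G" for g
    using that r_mem[OF that] by (simp add: r_def H.inv_FactGroup H.rcos_inv)
  \<comment> \<open>These match the degree condition on \<open>1\<close> with the vanishing condition on iterated components.\<close>
  have r_one_left: "r (g \<otimes>\<^bsub>G\<^esub> inv\<^bsub>G\<^esub> t) = \<one>\<^bsub>G Mod H\<^esub> \<longleftrightarrow> r g = r t"
    and r_one_right: "r (inv\<^bsub>G\<^esub> t \<otimes>\<^bsub>G\<^esub> g) = \<one>\<^bsub>G Mod H\<^esub> \<longleftrightarrow> r g = r t"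
    if "g \<in> carrier G" "t \<in> carrier G" for g t
  proof -
    have m: "r g \<in> carrier (G Mod H)" "r t \<in> carrier (G Mod H)" using r_mem that by blast+
    have "r g \<otimes>\<^bsub>G Mod H\<^esub> inv\<^bsub>G Mod H\<^esub> r t = \<one>\<^bsub>G Mod H\<^esub> \<longleftrightarrow> r g = r t"
      using m by (metis gr.Q.inv_equality gr.Q.inv_inv gr.Q.inv_closed gr.Q.r_inv)
    then show "r (g \<otimes>\<^bsub>G\<^esub> inv\<^bsub>G\<^esub> t) = \<one>\<^bsub>G Mod H\<^esub> \<longleftrightarrow> r g = r t"
      using that by (simp only: r_mult r_inv G.inv_closed)
    have "inv\<^bsub>G Mod H\<^esub> r t \<otimes>\<^bsub>G Mod H\<^esub> r g = \<one>\<^bsub>G Mod H\<^esub> \<longleftrightarrow> r g = r t"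
      using m by (metis gr.Q.inv_equality gr.Q.inv_inv gr.Q.inv_closed gr.Q.l_inv)
    then show "r (inv\<^bsub>G\<^esub> t \<otimes>\<^bsub>G\<^esub> g) = \<one>\<^bsub>G Mod H\<^esub> \<longleftrightarrow> r g = r t"
      using that by (simp only: r_mult r_inv G.inv_closed)
  qed
  have q_closed: "q (r g) a \<in> carrier A" if "g \<in> carrier G" "a \<in> carrier A" for g a
    using gr.comp_closed[OF fin that(2) r_mem[OF that(1)]] by (simp add: q_def)
  have average: "(\<Oplus>\<^bsub>A\<^esub> g \<in> carrier G. s \<odot>\<^bsub>A\<^esub> f (r g)) = (\<Oplus>\<^bsub>A\<^esub> x \<in> carrier (G Mod H). f x)"
    if "\<And>x. x \<in> carrier (G Mod H) \<Longrightarrow> f x \<in> carrier A" for f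
    unfolding r_def carrier_Q using s that
    by (intro gr.finsum_coset_average[OF assms(1,2) subH]) (auto simp: n_def carrier_Q)
  have q_one: "q (r g) \<one>\<^bsub>A\<^esub> = (if r g = \<one>\<^bsub>G Mod H\<^esub> then \<one>\<^bsub>A\<^esub> else \<zero>\<^bsub>A\<^esub>)"
    if "g \<in> carrier G" for g
    unfolding q_def using that
    by (intro gr.comp_homogeneous[OF fin _ gr.one_homogeneous[OF fin] r_mem] gr.Q.one_closed)
  have q_q: "q (r g) (q (r t) a) = (if r g = r t then q (r t) a else \<zero>\<^bsub>A\<^esub>)"
    if "g \<in> carrier G" "t \<in> carrier G" "a \<in> carrier A" for g t a
    unfolding q_def using that
    by (intro gr.comp_homogeneous[OF fin r_mem gr.comp_in_component[OF fin _ r_mem] r_mem])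
  have q_smult: "q (r g) (s \<odot>\<^bsub>A\<^esub> a) = s \<odot>\<^bsub>A\<^esub> q (r g) a" if "g \<in> carrier G" "a \<in> carrier A" for g a
    unfolding q_def using that s by (intro gr.comp_smult[OF fin] r_mem)
  have ss: "s \<odot>\<^bsub>A\<^esub> x \<otimes>\<^bsub>A\<^esub> (s \<odot>\<^bsub>A\<^esub> y) = s \<odot>\<^bsub>A\<^esub> (s \<odot>\<^bsub>A\<^esub> (x \<otimes>\<^bsub>A\<^esub> y))"
    if "x \<in> carrier A" "y \<in> carrier A" for x y
    using that s by (simp add: gr.smult_mult_left gr.smult_mult_right)
  have "partial_grading G K A (\<lambda>g a. s \<odot>\<^bsub>A\<^esub> q (g <#\<^bsub>G\<^esub> H) a)"
  proof (intro partial_grading.intro partial_grading_axioms.intro)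
    show "group G" by (rule assms(1))
    show "unital_algebra K A" by (rule gr.unital_algebra_axioms)
    show "finite (carrier G)" by (rule assms(2))
    fix g assume g: "g \<in> carrier G"
    have "q (r g) (a \<oplus>\<^bsub>A\<^esub> b) = q (r g) a \<oplus>\<^bsub>A\<^esub> q (r g) b"
      if "a \<in> carrier A" "b \<in> carrier A" for a b
      unfolding q_def using that by (intro gr.comp_add[OF fin] r_mem[OF g])
    moreover have "q (r g) (c \<odot>\<^bsub>A\<^esub> a) = c \<odot>\<^bsub>A\<^esub> q (r g) a"
      if "c \<in> carrier K" "a \<in> carrier A" for c a
      unfolding q_def using that by (intro gr.comp_smult[OF fin] r_mem[OF g])
    ultimately show "linear_operator K A (\<lambda>a. s \<odot>\<^bsub>A\<^esub> q (g <#\<^bsub>G\<^esub> H) a)"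
      using s q_closed[OF g] unfolding linear_operator_def lr[OF g]
      by (auto simp: gr.smult_r_distr gr.smult_assoc1[symmetric] F.m_comm)
  next
    fix a assume a: "a \<in> carrier A"
    have "(\<Oplus>\<^bsub>A\<^esub> g \<in> carrier G. s \<odot>\<^bsub>A\<^esub> q (g <#\<^bsub>G\<^esub> H) a) = (\<Oplus>\<^bsub>A\<^esub> g \<in> carrier G. s \<odot>\<^bsub>A\<^esub> q (r g) a)"
      using s q_closed a by (intro gr.finsum_cong') (auto simp: lr)
    also have "\<dots> = (\<Oplus>\<^bsub>A\<^esub> x \<in> carrier (G Mod H). q x a)"
      using gr.comp_closed[OF fin a] by (intro average) (simp add: q_def)
    also have "\<dots> = a" unfolding q_def by (rule gr.finsum_comp[OF fin a])
    finally show "(\<Oplus>\<^bsub>A\<^esub> g \<in> carrier G. s \<odot>\<^bsub>A\<^esub> q (g <#\<^bsub>G\<^esub> H) a) = a" .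
  next
    fix g a b assume g: "g \<in> carrier G" and ab: "a \<in> carrier A" "b \<in> carrier A"
    define f where "f x = q (r g \<otimes>\<^bsub>G Mod H\<^esub> inv\<^bsub>G Mod H\<^esub> x) a \<otimes>\<^bsub>A\<^esub> q x b" for x
    have f: "f x \<in> carrier A" if "x \<in> carrier (G Mod H)" for x
      unfolding f_def q_def using gr.comp_closed[OF fin] ab r_mem[OF g] that 
      by (intro gr.m_closed) (auto simp del: mult_FactGroup)
    have "(\<Oplus>\<^bsub>A\<^esub> l \<in> carrier G. s \<odot>\<^bsub>A\<^esub> q ((g \<otimes>\<^bsub>G\<^esub> inv\<^bsub>G\<^esub> l) <#\<^bsub>G\<^esub> H) a \<otimes>\<^bsub>A\<^esub> (s \<odot>\<^bsub>A\<^esub> q (l <#\<^bsub>G\<^esub> H) b))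
        = (\<Oplus>\<^bsub>A\<^esub> l \<in> carrier G. s \<odot>\<^bsub>A\<^esub> (s \<odot>\<^bsub>A\<^esub> f (r l)))"
    proof (rule gr.finsum_cong')
      fix l assume l: "l \<in> carrier G"
      have "f (r l) = q (r (g \<otimes>\<^bsub>G\<^esub> inv\<^bsub>G\<^esub> l)) a \<otimes>\<^bsub>A\<^esub> q (r l) b"
        using g l by (simp only: f_def r_mult r_inv G.inv_closed)
      then show "s \<odot>\<^bsub>A\<^esub> q ((g \<otimes>\<^bsub>G\<^esub> inv\<^bsub>G\<^esub> l) <#\<^bsub>G\<^esub> H) a \<otimes>\<^bsub>A\<^esub> (s \<odot>\<^bsub>A\<^esub> q (l <#\<^bsub>G\<^esub> H) b)
          = s \<odot>\<^bsub>A\<^esub> (s \<odot>\<^bsub>A\<^esub> f (r l))"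
        using g l ab q_closed by (simp add: lr ss)
    qed (use s f r_mem in auto)
    \<comment> \<open>Averaging absorbs one factor \<open>s\<close>; the other is the normalisation of the product.\<close>
    also have "\<dots> = (\<Oplus>\<^bsub>A\<^esub> x \<in> carrier (G Mod H). s \<odot>\<^bsub>A\<^esub> f x)"
      using s f by (intro average) auto
    also have "\<dots> = s \<odot>\<^bsub>A\<^esub> (\<Oplus>\<^bsub>A\<^esub> x \<in> carrier (G Mod H). f x)"
      using s f by (intro gr.finsum_smult_ldistr[symmetric] fin) auto
    also have "(\<Oplus>\<^bsub>A\<^esub> x \<in> carrier (G Mod H). f x) = q (r g) (a \<otimes>\<^bsub>A\<^esub> b)"
      unfolding f_def q_def by (rule gr.comp_mult[OF fin ab r_mem[OF g], symmetric])
    finally show "s \<odot>\<^bsub>A\<^esub> q (g <#\<^bsub>G\<^esub> H) (a \<otimes>\<^bsub>A\<^esub> b) =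
        (\<Oplus>\<^bsub>A\<^esub> l \<in> carrier G. s \<odot>\<^bsub>A\<^esub> q ((g \<otimes>\<^bsub>G\<^esub> inv\<^bsub>G\<^esub> l) <#\<^bsub>G\<^esub> H) a \<otimes>\<^bsub>A\<^esub> (s \<odot>\<^bsub>A\<^esub> q (l <#\<^bsub>G\<^esub> H) b))"
      by (simp add: lr[OF g])
  next
    fix g t a assume gt: "g \<in> carrier G" "t \<in> carrier G" and a: "a \<in> carrier A"
    have lhs: "s \<odot>\<^bsub>A\<^esub> q (g <#\<^bsub>G\<^esub> H) (s \<odot>\<^bsub>A\<^esub> q (t <#\<^bsub>G\<^esub> H) a)
        = s \<odot>\<^bsub>A\<^esub> (s \<odot>\<^bsub>A\<^esub> (if r g = r t then q (r t) a else \<zero>\<^bsub>A\<^esub>))"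
      using gt a q_closed by (simp add: lr q_smult q_q)
    show "s \<odot>\<^bsub>A\<^esub> q (g <#\<^bsub>G\<^esub> H) (s \<odot>\<^bsub>A\<^esub> q (t <#\<^bsub>G\<^esub> H) a) =
        s \<odot>\<^bsub>A\<^esub> q ((g \<otimes>\<^bsub>G\<^esub> inv\<^bsub>G\<^esub> t) <#\<^bsub>G\<^esub> H) \<one>\<^bsub>A\<^esub> \<otimes>\<^bsub>A\<^esub> (s \<odot>\<^bsub>A\<^esub> q (t <#\<^bsub>G\<^esub> H) a)"
      unfolding lhs using gt a q_closed
      by (simp add: lr ss q_one r_one_left del: one_FactGroup)
    show "s \<odot>\<^bsub>A\<^esub> q (g <#\<^bsub>G\<^esub> H) (s \<odot>\<^bsub>A\<^esub> q (t <#\<^bsub>G\<^esub> H) a) =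
        s \<odot>\<^bsub>A\<^esub> q (t <#\<^bsub>G\<^esub> H) a \<otimes>\<^bsub>A\<^esub> (s \<odot>\<^bsub>A\<^esub> q ((inv\<^bsub>G\<^esub> t \<otimes>\<^bsub>G\<^esub> g) <#\<^bsub>G\<^esub> H) \<one>\<^bsub>A\<^esub>)"
      unfolding lhs using gt a q_closed
      by (simp add: lr ss q_one r_one_right del: one_FactGroup)
  qed
  then show ?thesis by (simp add: s_def n_def q_def)
qed

end
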